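(* Let $\mathbb{K}$ be an algebraically closed field, $V$ a $\mathbb{K}$-vector space of finite positive dimension, and $\Phi=(A;\{E_i\}_{i=0}^d;A^*;\{E_i^*\}_{i=0}^d)$ a TD system on $V$ of diameter $d\geq 1$ that has $q$-Racah type, with fixed associated scalars $q,a,b$. Let $\mathcal{M}\in\mathrm{End}(V)$ and the subspaces $U_i,U_i^\Downarrow$ be as defined in the context. Then for $0\leq i\leq d$, $$(\mathcal{M} -q^{d-2i}I)U_i\subseteq U_0+U_1+\cdots+U_{i-1},$$ $$(\mathcal{M} -q^{d-2i}I)U_i^\Downarrow\subseteq U_0^\Downarrow+U_1^\Downarrow+\cdots+U_{i-1}^\Downarrow.$$
   Context: TD pair: an ordered pair of linear maps $A,A^*:V\to V$ such that (i) each is diagonalizable; (ii) there is an ordering $\{V_i\}_{i=0}^d$ of the eigenspaces of $A$ with $A^*V_i\subseteq V_{i-1}+V_i+V_{i+1}$ for $0\le i\le d$ ($V_{-1}=V_{d+1}=0$); (iii) there is an ordering $\{V_i^*\}_{i=0}^\delta$ of the eigenspaces of $A^*$ with $AV_i^*\subseteq V_{i-1}^*+V_i^*+V_{i+1}^*$ for $0\le i\le\delta$ ($V^*_{-1}=V^*_{\delta+1}=0$); (iv) no subspace $W$ with $0\ne W\ne V$ satisfies $AW\subseteq W$ and $A^*W\subseteq W$. It is known that $d=\delta$; $d$ is called the diameter. Orderings as in (ii), (iii) are called standard. The primitive idempotent of $A$ for an eigenspace $V_i$ is the projection of $V$ onto $V_i$ that vanishes on the other eigenspaces (similarly for $A^*$).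 TD system: $(A;\{E_i\}_{i=0}^d;A^*;\{E_i^*\}_{i=0}^d)$ where $A,A^*$ is a TD pair and $\{E_i\}$, $\{E_i^*\}$ are the primitive idempotents of $A$, $A^*$, in orders for which the corresponding eigenspace orderings $\{E_iV\}$, $\{E_i^*V\}$ are standard. Let $\theta_i$ (resp. $\theta_i^*$) be the eigenvalue of $A$ on $E_iV$ (resp. of $A^*$ on $E_i^*V$). $\Phi$ has $q$-Racah type if there are nonzero $q,a,b\in\mathbb{K}$ with $q^4\ne1$ and $\theta_i=aq^{d-2i}+a^{-1}q^{2i-d}$, $\theta_i^*=bq^{d-2i}+b^{-1}q^{2i-d}$ for $0\le i\le d$. (Distinctness of eigenvalues forces $q^{2i}\neq1$ for $1\le i\le d$, and $a^2\ne q^{2d-2},q^{2d-4},\dots,q^{2-2d}$; in particular $a^2\neq 1$.) Split decompositions: $U_i=(E_0^*V+\cdots+E_i^*V)\cap(E_iV+\cdots+E_dV)$ and $U_i^\Downarrow=(E_0^*V+\cdots+E_i^*V)\cap(E_0V+\cdots+E_{d-i}V)$ for $0\le i\le d$. It is known that $V=\bigoplus_i U_i=\bigoplus_i U_i^\Downarrow$ with all summands nonzero. $K,B\in\mathrm{End}(V)$ are the linear maps acting on $U_i$, respectively $U_i^\Downarrow$, as the scalar $q^{d-2i}$ ($0\le i\le d$). $\mathcal{M}\in\mathrm{End}(V)$: $\mathcal{M}=\dfrac{aK-a^{-1}B}{a-a^{-1}}$. Empty sums of subspaces are $0$. *)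

theory Defs
  imports
    "HOL-Computational_Algebra.Polynomial"
    "HOL-Library.Set_Algebras"
begin

text \<open>
  The vector space \<open>V\<close> is the whole type \<open>'b\<close>, with scalar multiplication \<open>scale\<close>.
  Sums of subspaces are the elementwise sums of sets of \<^theory>\<open>HOL-Library.Set_Algebras\<close>;
  in particular an empty sum of subspaces is \<open>0 = {0}\<close>.
\<close>

definition eigenspace ::
    "('a::field \<Rightarrow> 'b::ab_group_add \<Rightarrow> 'b) \<Rightarrow>
      ('b \<Rightarrow> 'b) \<Rightarrow> 'a \<Rightarrow> 'b set" where
  "eigenspace scale A \<theta> = {v. A v = scale \<theta> v}"

definition eigenspaces ::
    "('a::field \<Rightarrow> 'b::ab_group_add \<Rightarrow> 'b) \<Rightarrow>
      ('b \<Rightarrow> 'b) \<Rightarrow> 'b set set" where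
  "eigenspaces scale A = {eigenspace scale A \<theta> | \<theta>. eigenspace scale A \<theta> \<noteq> {0}}"

definition diagonalizable ::
    "('a::field \<Rightarrow> 'b::ab_group_add \<Rightarrow> 'b) \<Rightarrow>
      ('b \<Rightarrow> 'b) \<Rightarrow> bool" where
  "diagonalizable scale A \<longleftrightarrow> module.span scale (\<Union> (eigenspaces scale A)) = UNIV"

text \<open>
  \<open>W 0, \<dots>, W d\<close> is an ordering of all the eigenspaces of \<open>A\<close> on which \<open>B\<close> acts in a
  block-tridiagonal way. The index set of the sum is \<open>{i - 1, i, i + 1}\<close> cut down to
  \<open>{0, \<dots>, d}\<close>, which encodes the convention \<open>W (-1) = W (d + 1) = 0\<close>.
\<close>

definition standard_ordering ::
    "('a::field \<Rightarrow> 'b::ab_group_add \<Rightarrow> 'b) \<Rightarrow>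
      ('b \<Rightarrow> 'b) \<Rightarrow> ('b \<Rightarrow> 'b) \<Rightarrow> nat \<Rightarrow> (nat \<Rightarrow> 'b set) \<Rightarrow> bool" where
  "standard_ordering scale A B d W \<longleftrightarrow>
     bij_betw W {..d} (eigenspaces scale A) \<and>
     (\<forall>i\<le>d. B ` W i \<subseteq> (\<Sum>j\<in>{j. j \<le> d \<and> i \<le> j + 1 \<and> j \<le> i + 1}. W j))"

definition TD_pair ::
    "('a::field \<Rightarrow> 'b::ab_group_add \<Rightarrow> 'b) \<Rightarrow>
      ('b \<Rightarrow> 'b) \<Rightarrow> ('b \<Rightarrow> 'b) \<Rightarrow> bool" where
  "TD_pair scale A As \<longleftrightarrow>
     Vector_Spaces.linear scale scale A \<and> Vector_Spaces.linear scale scale As \<and>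
     diagonalizable scale A \<and> diagonalizable scale As \<and>
     (\<exists>d W. standard_ordering scale A As d W) \<and>
     (\<exists>\<delta> W. standard_ordering scale As A \<delta> W) \<and>
     \<not> (\<exists>W. module.subspace scale W \<and> W \<noteq> {0} \<and> W \<noteq> UNIV \<and> A ` W \<subseteq> W \<and> As ` W \<subseteq> W)"

text \<open>\<open>E\<close> is the primitive idempotent of \<open>A\<close> for the eigenspace \<open>W\<close>.\<close>

definition primitive_idempotent ::
    "('a::field \<Rightarrow> 'b::ab_group_add \<Rightarrow> 'b) \<Rightarrow>
      ('b \<Rightarrow> 'b) \<Rightarrow> 'b set \<Rightarrow> ('b \<Rightarrow> 'b) \<Rightarrow> bool" where
  "primitive_idempotent scale A W E \<longleftrightarrow>
     W \<in> eigenspaces scale A \<and> Vector_Spaces.linear scale scale E \<and>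
     range E = W \<and> (\<forall>v\<in>W. E v = v) \<and>
     (\<forall>W'\<in>eigenspaces scale A - {W}. \<forall>v\<in>W'. E v = 0)"

text \<open>
  Families indexed by \<open>0, \<dots>, d\<close> are functions on \<open>nat\<close> whose values beyond \<open>d\<close> are
  irrelevant. The subspace \<open>E i V\<close> is \<open>range (E i)\<close>.
\<close>

definition TD_system ::
    "('a::field \<Rightarrow> 'b::ab_group_add \<Rightarrow> 'b) \<Rightarrow>
      nat \<Rightarrow> ('b \<Rightarrow> 'b) \<Rightarrow> (nat \<Rightarrow> 'b \<Rightarrow> 'b) \<Rightarrow> ('b \<Rightarrow> 'b) \<Rightarrow> (nat \<Rightarrow> 'b \<Rightarrow> 'b) \<Rightarrow> bool" where
  "TD_system scale d A E As Es \<longleftrightarrow>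
     TD_pair scale A As \<and>
     (\<forall>i\<le>d. primitive_idempotent scale A (range (E i)) (E i)) \<and>
     (\<forall>i\<le>d. primitive_idempotent scale As (range (Es i)) (Es i)) \<and>
     standard_ordering scale A As d (\<lambda>i. range (E i)) \<and>
     standard_ordering scale As A d (\<lambda>i. range (Es i))"

definition eigenvalue_on ::
    "('a::field \<Rightarrow> 'b::ab_group_add \<Rightarrow> 'b) \<Rightarrow>
      ('b \<Rightarrow> 'b) \<Rightarrow> 'b set \<Rightarrow> 'a" where
  "eigenvalue_on scale A W = (THE \<theta>. \<forall>v\<in>W. A v = scale \<theta> v)"

definition q_Racah ::
    "('a::field \<Rightarrow> 'b::ab_group_add \<Rightarrow> 'b) \<Rightarrow>
      nat \<Rightarrow> ('b \<Rightarrow> 'b) \<Rightarrow> (nat \<Rightarrow> 'b \<Rightarrow> 'b) \<Rightarrow> ('b \<Rightarrow> 'b) \<Rightarrow> (nat \<Rightarrow> 'b \<Rightarrow> 'b)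
      \<Rightarrow> 'a \<Rightarrow> 'a \<Rightarrow> 'a \<Rightarrow> bool" where
  "q_Racah scale d A E As Es q a b \<longleftrightarrow>
     q \<noteq> 0 \<and> a \<noteq> 0 \<and> b \<noteq> 0 \<and> q ^ 4 \<noteq> 1 \<and>
     (\<forall>i\<le>d. eigenvalue_on scale A (range (E i)) =
        a * q powi (int d - 2 * int i) + inverse a * q powi (2 * int i - int d)) \<and>
     (\<forall>i\<le>d. eigenvalue_on scale As (range (Es i)) =
        b * q powi (int d - 2 * int i) + inverse b * q powi (2 * int i - int d))"

definition split_space ::
    "nat \<Rightarrow> (nat \<Rightarrow> 'b \<Rightarrow> 'b) \<Rightarrow> (nat \<Rightarrow> 'b \<Rightarrow> 'b) \<Rightarrow> nat \<Rightarrow> 'b::ab_group_add set" where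
  "split_space d E Es i =
     (\<Sum>j\<in>{0..i}. range (Es j)) \<inter> (\<Sum>j\<in>{i..d}. range (E j))"

definition split_space_down ::
    "nat \<Rightarrow> (nat \<Rightarrow> 'b \<Rightarrow> 'b) \<Rightarrow> (nat \<Rightarrow> 'b \<Rightarrow> 'b) \<Rightarrow> nat \<Rightarrow> 'b::ab_group_add set" where
  "split_space_down d E Es i =
     (\<Sum>j\<in>{0..i}. range (Es j)) \<inter> (\<Sum>j\<in>{0..d - i}. range (E j))"

text \<open>
  The linear map acting on each \<open>U i\<close> as \<open>q\<close> to the power \<open>d - 2 i\<close>; it exists and is unique
  whenever \<open>V\<close> is the direct sum of \<open>U 0, \<dots>, U d\<close>.
\<close>

definition weight_map ::
    "('a::field \<Rightarrow> 'b::ab_group_add \<Rightarrow> 'b) \<Rightarrow>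
      nat \<Rightarrow> 'a \<Rightarrow> (nat \<Rightarrow> 'b set) \<Rightarrow> 'b \<Rightarrow> 'b" where
  "weight_map scale d q U =
     (THE K. Vector_Spaces.linear scale scale K \<and>
        (\<forall>i\<le>d. \<forall>u\<in>U i. K u = scale (q powi (int d - 2 * int i)) u))"

definition K_map ::
    "('a::field \<Rightarrow> 'b::ab_group_add \<Rightarrow> 'b) \<Rightarrow>
      nat \<Rightarrow> (nat \<Rightarrow> 'b \<Rightarrow> 'b) \<Rightarrow> (nat \<Rightarrow> 'b \<Rightarrow> 'b) \<Rightarrow> 'a \<Rightarrow> 'b \<Rightarrow> 'b" where
  "K_map scale d E Es q = weight_map scale d q (split_space d E Es)"

definition B_map ::
    "('a::field \<Rightarrow> 'b::ab_group_add \<Rightarrow> 'b) \<Rightarrow>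
      nat \<Rightarrow> (nat \<Rightarrow> 'b \<Rightarrow> 'b) \<Rightarrow> (nat \<Rightarrow> 'b \<Rightarrow> 'b) \<Rightarrow> 'a \<Rightarrow> 'b \<Rightarrow> 'b" where
  "B_map scale d E Es q = weight_map scale d q (split_space_down d E Es)"

definition M_map ::
    "('a::field \<Rightarrow> 'b::ab_group_add \<Rightarrow> 'b) \<Rightarrow>
      nat \<Rightarrow> (nat \<Rightarrow> 'b \<Rightarrow> 'b) \<Rightarrow> (nat \<Rightarrow> 'b \<Rightarrow> 'b) \<Rightarrow> 'a \<Rightarrow> 'a \<Rightarrow> 'b \<Rightarrow> 'b" where
  "M_map scale d E Es q a v =
     scale (inverse (a - inverse a))
       (scale a (K_map scale d E Es q v) - scale (inverse a) (B_map scale d E Es q v))"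

end

theory Submission
  imports Defs
begin

text \<open>
  Write \<open>F i = E\<^sup>*\<^sub>0V + \<dots> + E\<^sup>*\<^sub>iV\<close>. Both split decompositions refine this flag:
  \<open>F i\<close> is the sum of the first \<open>i + 1\<close> summands of either one. Hence \<open>K\<close> and \<open>B\<close> both act as
  \<open>q\<^bsup>d-2i\<^esup>\<close> on \<open>F i\<close> modulo \<open>F (i - 1)\<close>, and so does \<open>\<M>\<close>, whose coefficients add up to one.
  That the split decompositions are direct and refine the flag follows from irreducibility: with
  \<open>G j = E\<^sub>jV + \<dots> + E\<^sub>dV\<close>, the space \<open>\<Sum>i. F i \<inter> G (i + r)\<close> is invariant under \<open>A\<close> and \<open>A\<^sup>*\<close>,
  thus zero for \<open>r \<ge> 1\<close> and everything for \<open>r = 0\<close>.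
\<close>

section \<open>Sums of subspaces and eigenspaces of a linear map\<close>

context vector_space
begin

lemma subspace_set_sum:
  assumes "\<And>i. i \<in> I \<Longrightarrow> subspace (S i)"
  shows "subspace (\<Sum>i\<in>I. S i)"
proof (cases "finite I")
  case True
  then show ?thesis using assms
  proof (induction I rule: finite_induct)
    case (insert j I)
    then have "subspace {x + y |x y. x \<in> S j \<and> y \<in> (\<Sum>i\<in>I. S i)}"
      by (intro subspace_sums) auto
    moreover have "(\<Sum>i\<in>insert j I. S i) = {x + y |x y. x \<in> S j \<and> y \<in> (\<Sum>i\<in>I. S i)}"
      unfolding sum.insert[OF insert.hyps] set_plus_def by blast
    ultimately show ?case by simp
  qed (simp add: set_zero)
qed (simp add: set_zero)

lemma set_sum_superset:
  assumes "finite I" "\<And>i. i \<in> I \<Longrightarrow> subspace (S i)" "j \<in> I"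
  shows "S j \<subseteq> (\<Sum>i\<in>I. S i)"
proof
  fix x assume "x \<in> S j"
  have "x = (\<Sum>i\<in>I. if i = j then x else 0)"
    using assms by simp
  moreover have "\<forall>i\<in>I. (if i = j then x else 0) \<in> S i"
    using assms \<open>x \<in> S j\<close> by (auto intro: subspace_0)
  ultimately show "x \<in> (\<Sum>i\<in>I. S i)"
    unfolding set_sum_alt[OF assms(1)] by blast
qed

lemma set_sum_least:
  assumes "subspace P" "\<And>i. i \<in> I \<Longrightarrow> S i \<subseteq> P"
  shows "(\<Sum>i\<in>I. S i) \<subseteq> P"
proof (cases "finite I")
  case True
  show ?thesis
    unfolding set_sum_alt[OF True] using assms by (auto intro!: subspace_sum)
next
  case False
  then show ?thesis using assms by (simp add: set_zero subspace_0)
qed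

lemma set_sum_mono:
  assumes "finite J" "I \<subseteq> J" "\<And>i. i \<in> J \<Longrightarrow> subspace (S i)"
  shows "(\<Sum>i\<in>I. S i) \<subseteq> (\<Sum>i\<in>J. S i)"
  using assms by (intro set_sum_least subspace_set_sum set_sum_superset) auto

text \<open>The preimage of \<open>P\<close> under \<open>f\<close> is a subspace, so it contains
  the sum once it contains every summand. Invariance and shift properties of sums are reduced to
  single summands in this way.\<close>

lemma linear_set_sum_mem:
  assumes "Vector_Spaces.linear scale scale f" "subspace P" "v \<in> (\<Sum>i\<in>I. S i)"
    and "\<And>i v. \<lbrakk>i \<in> I; v \<in> S i\<rbrakk> \<Longrightarrow> f v \<in> P"
  shows "f v \<in> P"
proof -
  interpret f: Vector_Spaces.linear scale scale f by fact
  have "subspace (f -` P)"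
    using assms(2) by (rule f.subspace_vimage)
  then have "(\<Sum>i\<in>I. S i) \<subseteq> f -` P"
    by (rule set_sum_least) (use assms(4) in blast)
  with assms(3) show ?thesis by blast
qed

lemma linear_minus_scale:
  assumes "Vector_Spaces.linear scale scale f"
  shows "Vector_Spaces.linear scale scale (\<lambda>v. f v - scale c v)"
proof -
  interpret f: Vector_Spaces.linear scale scale f by fact
  show ?thesis
    by unfold_locales (simp_all add: f.add f.scale scale_right_distrib scale_right_diff_distrib mult.commute)
qed

lemma eigenspace_subspace:
  assumes "Vector_Spaces.linear scale scale f"
  shows "subspace (eigenspace scale f c)"
proof -
  interpret f: Vector_Spaces.linear scale scale f by fact
  show ?thesis
    unfolding eigenspace_def
    by (rule subspaceI) (simp_all add: f.add f.scale f.zero scale_right_distrib mult.commute)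
qed

text \<open>A nonzero eigenvector determines its scalar, which makes the \<open>THE\<close> in
  \<open>eigenvalue_on\<close> well defined; on the zero space every scalar would qualify.\<close>

lemma eigenvalue_on_eigenspace:
  assumes "eigenspace scale f c \<noteq> {0}" "Vector_Spaces.linear scale scale f"
  shows "eigenvalue_on scale f (eigenspace scale f c) = c"
proof -
  have "0 \<in> eigenspace scale f c"
    using eigenspace_subspace[OF assms(2)] by (rule subspace_0)
  with assms obtain v where v: "v \<in> eigenspace scale f c" "v \<noteq> 0" by blast
  show ?thesis
    unfolding eigenvalue_on_def
  proof (rule the_equality)
    show "\<forall>v\<in>eigenspace scale f c. f v = scale c v" by (simp add: eigenspace_def)
    fix c' assume "\<forall>v\<in>eigenspace scale f c. f v = scale c' v"
    with v(1) have "f v = scale c' v" by (rule bspec[rotated])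
    moreover have "f v = scale c v" using v(1) by (simp add: eigenspace_def)
    ultimately have "scale c' v = scale c v" by (rule trans[OF sym])
    then show "c' = c" using v(2) by simp
  qed
qed

lemma eigenspaces_eq_eigenspace:
  assumes "W \<in> eigenspaces scale f" "Vector_Spaces.linear scale scale f"
  shows "W = eigenspace scale f (eigenvalue_on scale f W)"
proof -
  obtain c where "W = eigenspace scale f c" "eigenspace scale f c \<noteq> {0}"
    using assms(1) by (auto simp: eigenspaces_def)
  with eigenvalue_on_eigenspace assms(2) show ?thesis by simp
qed

end

section \<open>Two opposite flags and the decomposition they split\<close>

text \<open>Stated for abstract flags so that both split decompositions become instances with the
  same \<open>F\<close>. The flag \<open>G\<close> decreases and runs one index further than
  \<open>F\<close>, to reach zero at \<open>Suc d\<close>. Irreducibility leaves two options for an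
  invariant subspace: \<open>G_1\<close> decides between them for positive shifts,
  \<open>F_0_nonzero\<close> for shift zero.\<close>

locale split_flags = vector_space scale
  for scale :: "'a::field \<Rightarrow> 'b::ab_group_add \<Rightarrow> 'b" +
  fixes d :: nat and A As :: "'b \<Rightarrow> 'b" and F G :: "nat \<Rightarrow> 'b set" and th ths :: "nat \<Rightarrow> 'a"
  assumes linA: "Vector_Spaces.linear scale scale A"
    and linAs: "Vector_Spaces.linear scale scale As"
    and irred: "\<And>W. \<lbrakk>subspace W; A ` W \<subseteq> W; As ` W \<subseteq> W\<rbrakk> \<Longrightarrow> W = {0} \<or> W = UNIV"
    and F_sub: "i \<le> d \<Longrightarrow> subspace (F i)"
    and G_sub: "i \<le> Suc d \<Longrightarrow> subspace (G i)"
    and F_mono: "\<lbrakk>i \<le> j; j \<le> d\<rbrakk> \<Longrightarrow> F i \<subseteq> F j"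
    and G_antimono: "\<lbrakk>i \<le> j; j \<le> Suc d\<rbrakk> \<Longrightarrow> G j \<subseteq> G i"
    and F_0: "v \<in> F 0 \<Longrightarrow> As v = scale (ths 0) v"
    and F_lower: "\<lbrakk>Suc i \<le> d; v \<in> F (Suc i)\<rbrakk> \<Longrightarrow> As v - scale (ths (Suc i)) v \<in> F i"
    and F_raise: "\<lbrakk>Suc i \<le> d; v \<in> F i\<rbrakk> \<Longrightarrow> A v \<in> F (Suc i)"
    and G_raise: "\<lbrakk>i \<le> d; v \<in> G i\<rbrakk> \<Longrightarrow> A v - scale (th i) v \<in> G (Suc i)"
    and G_lower: "\<lbrakk>Suc i \<le> d; v \<in> G (Suc i)\<rbrakk> \<Longrightarrow> As v \<in> G i"
    and G_last: "G (Suc d) = {0}"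
    and G_first: "G 0 = UNIV"
    and G_1: "G 1 \<noteq> UNIV"
    and F_0_nonzero: "F 0 \<noteq> {0}"
begin

definition U :: "nat \<Rightarrow> 'b set" where "U i = F i \<inter> G i"

text \<open>The bound keeps \<open>i + r \<le> d\<close>. Natural subtraction makes it meaningful
  only for \<open>r \<le> d\<close>, hence that hypothesis in the lemmas below.\<close>

definition diag :: "nat \<Rightarrow> 'b set" where
  "diag r = (\<Sum>i\<in>{..d - r}. F i \<inter> G (i + r))"

lemma diag_summand_subspace: "r \<le> d \<Longrightarrow> i \<in> {..d - r} \<Longrightarrow> subspace (F i \<inter> G (i + r))"
  by (auto intro!: subspace_inter F_sub G_sub)

lemma subspace_diag: "r \<le> d \<Longrightarrow> subspace (diag r)"
  unfolding diag_def by (intro subspace_set_sum diag_summand_subspace)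

lemma diag_superset:
  assumes "i + r \<le> d"
  shows "F i \<inter> G (i + r) \<subseteq> diag r"
proof -
  have "r \<le> d" "i \<in> {..d - r}" using assms by auto
  then show ?thesis
    unfolding diag_def by (intro set_sum_superset[of _ "\<lambda>i. F i \<inter> G (i + r)"] diag_summand_subspace) auto
qed

text \<open>On the summand with index \<open>i\<close>, the map \<open>A - th (i + r)\<close> raises
  the indices of \<open>F\<close> and \<open>G\<close> together, so the image stays on the same
  diagonal; the subtracted multiple of \<open>v\<close> is then added back.\<close>

lemma diag_A_invariant:
  assumes r: "r \<le> d"
  shows "A ` diag r \<subseteq> diag r"
proof (rule image_subsetI)
  fix v assume "v \<in> diag r"
  then show "A v \<in> diag r"
  \<comment> \<open>One half of the defining equation turns membership in \<open>diag r\<close> into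
    membership in the sum, so single summands suffice.\<close>
  proof (rule linear_set_sum_mem[OF linA subspace_diag[OF r] diag_def[of r, THEN equalityD1, THEN subsetD]])
    fix i v assume i: "i \<in> {..d - r}" and v: "v \<in> F i \<inter> G (i + r)"
    have ir: "i + r \<le> d" using i r by auto
    have vd: "v \<in> diag r" using diag_superset[OF ir] v by blast
    define w where "w = A v - scale (th (i + r)) v"
    have w: "w \<in> G (Suc i + r)"
      using G_raise[OF ir, of v] v by (simp add: w_def)
    have "w \<in> diag r"
    proof (cases "i + r = d")
      \<comment> \<open>At the end of the diagonal the raised vector lies in
        \<open>G (Suc d)\<close>, which is zero.\<close>
      case True
      with w have "w = 0" using G_last by (simp add: add.commute)
      then show ?thesis using subspace_0[OF subspace_diag[OF r]] by simp
    next
      case False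
      then have le: "Suc i + r \<le> d" using ir by simp
      have "A v \<in> F (Suc i)" using F_raise[of i v] le v by auto
      moreover have "v \<in> F (Suc i)" using F_mono[of i "Suc i"] le v by auto
      ultimately have "w \<in> F (Suc i)"
        unfolding w_def using F_sub[of "Suc i"] le by (intro subspace_diff subspace_scale) auto
      with w show ?thesis using diag_superset[OF le] by blast
    qed
    then have "w + scale (th (i + r)) v \<in> diag r"
      using subspace_diag[OF r] vd by (intro subspace_add subspace_scale)
    then show "A v \<in> diag r" by (simp add: w_def)
  qed
qed

text \<open>Dual to the case of \<open>A\<close>: the map \<open>As - ths i\<close> lowers the
  indices of \<open>F\<close> and \<open>G\<close> together, and it kills the summand at
  \<open>i = 0\<close>.\<close>

lemma diag_As_invariant:
  assumes r: "r \<le> d"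
  shows "As ` diag r \<subseteq> diag r"
proof (rule image_subsetI)
  fix v assume "v \<in> diag r"
  then show "As v \<in> diag r"
  proof (rule linear_set_sum_mem[OF linAs subspace_diag[OF r] diag_def[of r, THEN equalityD1, THEN subsetD]])
    fix i v assume i: "i \<in> {..d - r}" and v: "v \<in> F i \<inter> G (i + r)"
    have ir: "i + r \<le> d" using i r by auto
    have vd: "v \<in> diag r" using diag_superset[OF ir] v by blast
    define w where "w = As v - scale (ths i) v"
    have "w \<in> diag r"
    proof (cases i)
      case 0
      then have "w = 0" using F_0 v by (simp add: w_def)
      then show ?thesis using subspace_0[OF subspace_diag[OF r]] by simp
    next
      case (Suc k)
      have kr: "k + r \<le> d" using ir Suc by simp
      have "w \<in> F k" using F_lower[of k v] Suc ir v by (simp add: w_def)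
      moreover have "As v \<in> G (k + r)" using G_lower[of "k + r" v] Suc ir v by simp
      moreover have "v \<in> G (k + r)" using G_antimono[of "k + r" "i + r"] Suc ir v by auto
      ultimately have "w \<in> F k \<inter> G (k + r)"
        unfolding w_def using G_sub[of "k + r"] kr by (auto intro!: subspace_diff subspace_scale)
      then show ?thesis using diag_superset[OF kr] by blast
    qed
    then have "w + scale (ths i) v \<in> diag r"
      using subspace_diag[OF r] vd by (intro subspace_add subspace_scale)
    then show "As v \<in> diag r" by (simp add: w_def)
  qed
qed

lemma diag_trivial: "r \<le> d \<Longrightarrow> diag r = {0} \<or> diag r = UNIV"
  by (intro irred subspace_diag diag_A_invariant diag_As_invariant)

text \<open>The intersection is a summand of \<open>diag (j - i)\<close>. As the shift is positive,
  that space lies in \<open>G 1\<close>, so it is proper and therefore zero.\<close>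

lemma F_inter_G:
  assumes "i < j" "j \<le> d"
  shows "F i \<inter> G j = {0}"
proof -
  define r where "r = j - i"
  have r: "1 \<le> r" "i + r = j" "r \<le> d" using assms by (auto simp: r_def)
  have "F k \<inter> G (k + r) \<subseteq> G 1" if "k \<in> {..d - r}" for k
  proof -
    have "1 \<le> k + r" "k + r \<le> Suc d" using r(1,3) that by auto
    then show ?thesis using G_antimono by blast
  qed
  then have "diag r \<subseteq> G 1"
    unfolding diag_def by (intro set_sum_least G_sub) auto
  with G_1 diag_trivial[OF r(3)] have "diag r = {0}" by blast
  with diag_superset[of i r] r assms have "F i \<inter> G j \<subseteq> {0}" by simp
  moreover have "0 \<in> F i \<inter> G j" using F_sub[of i] G_sub[of j] assms by (auto intro: subspace_0)
  ultimately show ?thesis by blast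
qed

lemma subspace_U: "i \<le> d \<Longrightarrow> subspace (U i)"
  unfolding U_def by (intro subspace_inter F_sub G_sub) auto

text \<open>The sum is \<open>diag 0\<close>, which contains \<open>F 0 \<inter> G 0 = F 0\<close>
  and hence is not zero.\<close>

lemma sum_U_UNIV: "(\<Sum>i\<in>{..d}. U i) = UNIV"
proof -
  have "F 0 \<subseteq> diag 0" using diag_superset[of 0 0] G_first by simp
  with F_0_nonzero subspace_0[OF F_sub[of 0]] have "diag 0 \<noteq> {0}" by blast
  with diag_trivial[of 0] show ?thesis by (simp add: diag_def U_def)
qed

lemma U_subset_F: "\<lbrakk>i \<le> j; j \<le> d\<rbrakk> \<Longrightarrow> U i \<subseteq> F j"
  using F_mono[of i j] by (auto simp: U_def)

lemma sum_U_subset_F: "i \<le> d \<Longrightarrow> (\<Sum>j\<in>{..i}. U j) \<subseteq> F i"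
  by (intro set_sum_least F_sub U_subset_F) auto

text \<open>Expand a vector of \<open>F i\<close> in \<open>U 0, ..., U (n + 1)\<close> with
  \<open>n \<ge> i\<close>: its top component lies in \<open>F n \<inter> G (n + 1) = {0}\<close>.
  Top components can thus be discarded one at a time, starting from the expansion of length
  \<open>d\<close> that every vector has.\<close>

lemma F_eq_sum_U:
  assumes "i \<le> d"
  shows "F i = (\<Sum>j\<in>{..i}. U j)"
proof
  have "F i \<inter> (\<Sum>j\<in>{..n}. U j) \<subseteq> (\<Sum>j\<in>{..i}. U j)" if "i \<le> n" "n \<le> d" for n
    using that
  proof (induction n rule: dec_induct)
    case (step n)
    have "F i \<inter> (\<Sum>j\<in>{..Suc n}. U j) \<subseteq> (\<Sum>j\<in>{..n}. U j)"
    proof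
      fix v assume v: "v \<in> F i \<inter> (\<Sum>j\<in>{..Suc n}. U j)"
      then obtain x y where xy: "v = x + y" "x \<in> (\<Sum>j\<in>{..n}. U j)" "y \<in> U (Suc n)"
        by (auto simp: set_plus_def add.commute)
      have "x \<in> F n" using sum_U_subset_F[of n] xy(2) step.prems by auto
      moreover have "v \<in> F n" using F_mono[of i n] step v by auto
      ultimately have "v - x \<in> F n" using F_sub[of n] step.prems by (intro subspace_diff) auto
      moreover have "y = v - x" using xy by simp
      ultimately have "y \<in> F n \<inter> G (Suc n)" using xy(3) by (simp add: U_def)
      then have "y = 0" using F_inter_G[of n "Suc n"] step.prems by simp
      with xy show "v \<in> (\<Sum>j\<in>{..n}. U j)" by simp
    qed
    with step show ?case by auto
  qed simp
  from this[of d] assms show "F i \<subseteq> (\<Sum>j\<in>{..i}. U j)" by (simp add: sum_U_UNIV)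
qed (rule sum_U_subset_F[OF assms])

text \<open>In a vanishing sum the last term is minus the sum of the earlier ones, so it lies in
  \<open>F n\<close> as well as in \<open>G (Suc n)\<close> and is zero; induction removes the
  others.\<close>

lemma U_independent:
  assumes "n \<le> d" "\<And>j. j \<le> n \<Longrightarrow> u j \<in> U j" "(\<Sum>j\<le>n. u j) = 0" "j \<le> n"
  shows "u j = 0"
  using assms
proof (induction n)
  case (Suc n)
  have "u (Suc n) = - (\<Sum>j\<le>n. u j)" using Suc.prems(3) by (simp add: eq_neg_iff_add_eq_0 add.commute)
  moreover have "(\<Sum>j\<le>n. u j) \<in> F n"
    using Suc.prems U_subset_F[of _ n] F_sub[of n] by (intro subspace_sum) fastforce+
  ultimately have "u (Suc n) \<in> F n" using F_sub[of n] Suc.prems by (auto intro: subspace_neg)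
  moreover have "u (Suc n) \<in> G (Suc n)" using Suc.prems(2)[of "Suc n"] by (simp add: U_def)
  ultimately have 0: "u (Suc n) = 0" using F_inter_G[of n "Suc n"] Suc.prems by auto
  then show ?case using Suc by (cases "j = Suc n") auto
qed simp

text \<open>The whole family is chosen at once. Independence fixes its values up to index
  \<open>d\<close>; beyond \<open>d\<close> they are arbitrary.\<close>

definition component :: "'b \<Rightarrow> nat \<Rightarrow> 'b" where
  "component v = (SOME u. (\<forall>j\<le>d. u j \<in> U j) \<and> v = (\<Sum>j\<le>d. u j))"

lemma component: "j \<le> d \<Longrightarrow> component v j \<in> U j" "(\<Sum>j\<le>d. component v j) = v"
proof -
  have "v \<in> (\<Sum>i\<in>{..d}. U i)" by (simp add: sum_U_UNIV)
  then have "\<exists>u. (\<forall>j\<le>d. u j \<in> U j) \<and> v = (\<Sum>j\<le>d. u j)"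
    by (auto simp: set_sum_alt)
  from someI_ex[OF this, folded component_def]
  show "j \<le> d \<Longrightarrow> component v j \<in> U j" "(\<Sum>j\<le>d. component v j) = v" by auto
qed

lemma component_unique:
  assumes "\<And>j. j \<le> d \<Longrightarrow> u j \<in> U j" "(\<Sum>j\<le>d. u j) = v" "j \<le> d"
  shows "component v j = u j"
proof -
  have "component v j - u j = 0"
    by (rule U_independent[of d "\<lambda>j. component v j - u j"])
       (use assms component in \<open>auto simp: sum_subtractf intro!: subspace_diff subspace_U\<close>)
  then show ?thesis by simp
qed

text \<open>This justifies the \<open>THE\<close> in \<open>weight_map\<close>. Existence scales the
  components of a vector, which depend linearly on it; uniqueness holds because the
  \<open>U i\<close> sum to the whole space.\<close>

lemma ex1_linear_scaling_U:
  "\<exists>!K. Vector_Spaces.linear scale scale K \<and> (\<forall>i\<le>d. \<forall>u\<in>U i. K u = scale (c i) u)"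
proof (rule ex_ex1I)
  define K where "K v = (\<Sum>j\<le>d. scale (c j) (component v j))" for v
  have add: "component (v + w) j = component v j + component w j" if "j \<le> d" for v w j
    by (rule component_unique)
       (use that component in \<open>auto simp: sum.distrib intro!: subspace_add subspace_U\<close>)
  have sc: "component (scale k v) j = scale k (component v j)" if "j \<le> d" for k v j
    by (rule component_unique)
       (use that component in \<open>auto simp: scale_sum_right[symmetric] intro!: subspace_scale subspace_U\<close>)
  have "Vector_Spaces.linear scale scale K"
    by unfold_locales
       (simp_all add: K_def add sc scale_right_distrib sum.distrib scale_sum_right mult.commute)
  moreover have "K u = scale (c i) u" if "i \<le> d" "u \<in> U i" for i u
  proof -
    have "component u j = (if j = i then u else 0)" if "j \<le> d" for j
      by (rule component_unique)
         (use that \<open>i \<le> d\<close> \<open>u \<in> U i\<close> in \<open>auto intro: subspace_0 subspace_U\<close>)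
    then have "K u = (\<Sum>j\<le>d. if j = i then scale (c i) u else 0)"
      unfolding K_def by (intro sum.cong) auto
    with \<open>i \<le> d\<close> show ?thesis by simp
  qed
  ultimately show "\<exists>K. Vector_Spaces.linear scale scale K \<and> (\<forall>i\<le>d. \<forall>u\<in>U i. K u = scale (c i) u)"
    by blast
next
  fix K L
  assume K: "Vector_Spaces.linear scale scale K \<and> (\<forall>i\<le>d. \<forall>u\<in>U i. K u = scale (c i) u)"
    and L: "Vector_Spaces.linear scale scale L \<and> (\<forall>i\<le>d. \<forall>u\<in>U i. L u = scale (c i) u)"
  interpret K: Vector_Spaces.linear scale scale K using K by blast
  interpret L: Vector_Spaces.linear scale scale L using L by blast
  show "K = L"
  proof
    fix v
    have "K (\<Sum>j\<le>d. component v j) = L (\<Sum>j\<le>d. component v j)"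
      unfolding K.sum L.sum using K L component(1) by (intro sum.cong) auto
    then show "K v = L v" by (simp add: component(2))
  qed
qed

text \<open>Expand \<open>v\<close> in \<open>U 0, ..., U i\<close>. Subtracting the weight of index
  \<open>i\<close> multiplies the component in \<open>U j\<close> by a difference of weights, which
  vanishes at \<open>j = i\<close>.\<close>

lemma weight_map_on_F:
  assumes "i \<le> d" "v \<in> F i"
  shows "weight_map scale d q U v - scale (q powi (int d - 2 * int i)) v \<in> (\<Sum>j\<in>{..<i}. U j)"
proof -
  define c where "c i = q powi (int d - 2 * int i)" for i
  define K where "K = weight_map scale d q U"
  have K: "Vector_Spaces.linear scale scale K" "\<And>i u. \<lbrakk>i \<le> d; u \<in> U i\<rbrakk> \<Longrightarrow> K u = scale (c i) u"
    using theI'[OF ex1_linear_scaling_U[of c]] unfolding K_def weight_map_def c_def by blast+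
  interpret K: Vector_Spaces.linear scale scale K by fact
  obtain u where u: "\<And>j. j \<le> i \<Longrightarrow> u j \<in> U j" "v = (\<Sum>j\<le>i. u j)"
    using assms by (auto simp: F_eq_sum_U set_sum_alt)
  have "K v - scale (c i) v = (\<Sum>j\<le>i. scale (c j - c i) (u j))"
    unfolding u(2) K.sum scale_sum_right sum_subtractf[symmetric] using assms u(1) K(2)
    by (intro sum.cong) (auto simp: scale_left_diff_distrib)
  \<comment> \<open>The term \<open>j = i\<close> has coefficient zero and drops out.\<close>
  also have "\<dots> = (\<Sum>j<i. scale (c j - c i) (u j))"
    by (simp add: lessThan_Suc_atMost[symmetric])
  also have "\<dots> \<in> (\<Sum>j\<in>{..<i}. U j)"
    unfolding set_sum_alt[OF finite_lessThan] using u(1) assms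
    by (force intro: subspace_scale subspace_U)
  finally show ?thesis by (simp add: c_def K_def)
qed

end

section \<open>Flags built from partial sums of eigenspaces\<close>

context vector_space
begin

text \<open>Subtracting an eigenvalue scales every eigenspace and kills its own, which removes the
  end term of a partial sum. The other map moves indices by at most one, by tridiagonality, so it
  extends a partial sum by at most one term.\<close>

lemma split_flags_eigenspaces:
  assumes linA: "Vector_Spaces.linear scale scale A" and linAs: "Vector_Spaces.linear scale scale As"
    and irred: "\<And>W. \<lbrakk>subspace W; A ` W \<subseteq> W; As ` W \<subseteq> W\<rbrakk> \<Longrightarrow> W = {0} \<or> W = UNIV"
    and T: "\<And>i. i \<le> d \<Longrightarrow> T i = eigenspace scale A (th i)"
    and S: "\<And>i. i \<le> d \<Longrightarrow> S i = eigenspace scale As (ths i)"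
    and tri: "\<And>i. i \<le> d \<Longrightarrow> As ` T i \<subseteq> (\<Sum>j\<in>{j. j \<le> d \<and> i \<le> j + 1 \<and> j \<le> i + 1}. T j)"
    and tris: "\<And>i. i \<le> d \<Longrightarrow> A ` S i \<subseteq> (\<Sum>j\<in>{j. j \<le> d \<and> i \<le> j + 1 \<and> j \<le> i + 1}. S j)"
    and T_UNIV: "(\<Sum>j\<in>{0..d}. T j) = UNIV"
    and T_1: "(\<Sum>j\<in>{1..d}. T j) \<noteq> UNIV"
    and S_0: "S 0 \<noteq> {0}"
  shows "split_flags scale d A As (\<lambda>i. \<Sum>j\<in>{0..i}. S j) (\<lambda>i. \<Sum>j\<in>{i..d}. T j) th ths"
proof -
  have sT: "subspace (T i)" if "i \<le> d" for i
    unfolding T[OF that] by (rule eigenspace_subspace[OF linA])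
  have sS: "subspace (S i)" if "i \<le> d" for i
    unfolding S[OF that] by (rule eigenspace_subspace[OF linAs])
  show ?thesis
  proof (intro split_flags.intro split_flags_axioms.intro)
    show "vector_space scale" by (rule vector_space_axioms)
    show "Vector_Spaces.linear scale scale A" "Vector_Spaces.linear scale scale As" by fact+
    show "\<And>W. \<lbrakk>subspace W; A ` W \<subseteq> W; As ` W \<subseteq> W\<rbrakk> \<Longrightarrow> W = {0} \<or> W = UNIV" by fact
    show subS: "subspace (\<Sum>j\<in>{0..i}. S j)" if "i \<le> d" for i
      using that by (intro subspace_set_sum sS) auto
    show subT: "subspace (\<Sum>j\<in>{i..d}. T j)" for i
      by (intro subspace_set_sum sT) auto
    show "(\<Sum>j\<in>{0..i}. S j) \<subseteq> (\<Sum>j\<in>{0..j}. S j)" if "i \<le> j" "j \<le> d" for i j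
      using that by (intro set_sum_mono sS) auto
    show "(\<Sum>j\<in>{j..d}. T j) \<subseteq> (\<Sum>j\<in>{i..d}. T j)" if "i \<le> j" for i j
      using that by (intro set_sum_mono sT) auto
    show "As v = scale (ths 0) v" if "v \<in> (\<Sum>j\<in>{0..0}. S j)" for v
      using that S[of 0] by (simp add: eigenspace_def)
    show "As v - scale (ths (Suc i)) v \<in> (\<Sum>j\<in>{0..i}. S j)"
      if i: "Suc i \<le> d" and v: "v \<in> (\<Sum>j\<in>{0..Suc i}. S j)" for i v
    proof (rule linear_set_sum_mem[OF linear_minus_scale[OF linAs] subS[OF Suc_leD[OF i]] v])
      fix j v assume j': "j \<in> {0..Suc i}" and v: "v \<in> S j"
      have j: "j \<le> d" using j' i by auto
      have eq: "As v - scale (ths (Suc i)) v = scale (ths j - ths (Suc i)) v"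
        using v S[OF j] by (simp add: eigenspace_def scale_left_diff_distrib)
      show "As v - scale (ths (Suc i)) v \<in> (\<Sum>j\<in>{0..i}. S j)"
      proof (cases "j = Suc i")
        case True
        then show ?thesis unfolding eq using i subspace_0[OF subS[of i]] by simp
      next
        case False
        then have "S j \<subseteq> (\<Sum>j\<in>{0..i}. S j)"
          using j' i by (intro set_sum_superset sS) auto
        then show ?thesis unfolding eq using v subS[of i] i by (auto intro: subspace_scale)
      qed
    qed
    show "A v \<in> (\<Sum>j\<in>{0..Suc i}. S j)" if i: "Suc i \<le> d" and v: "v \<in> (\<Sum>j\<in>{0..i}. S j)" for i v
    proof (rule linear_set_sum_mem[OF linA subS[OF i] v])
      fix j v assume j: "j \<in> {0..i}" and v: "v \<in> S j"
      have "A ` S j \<subseteq> (\<Sum>j\<in>{0..Suc i}. S j)"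
        by (rule order.trans[OF tris set_sum_mono]) (use j i sS in auto)
      with v show "A v \<in> (\<Sum>j\<in>{0..Suc i}. S j)" by blast
    qed
    show "A v - scale (th i) v \<in> (\<Sum>j\<in>{Suc i..d}. T j)"
      if i: "i \<le> d" and v: "v \<in> (\<Sum>j\<in>{i..d}. T j)" for i v
    proof (rule linear_set_sum_mem[OF linear_minus_scale[OF linA] subT v])
      fix j v assume j': "j \<in> {i..d}" and v: "v \<in> T j"
      have j: "j \<le> d" using j' by auto
      have eq: "A v - scale (th i) v = scale (th j - th i) v"
        using v T[OF j] by (simp add: eigenspace_def scale_left_diff_distrib)
      show "A v - scale (th i) v \<in> (\<Sum>j\<in>{Suc i..d}. T j)"
      proof (cases "j = i")
        case True
        then show ?thesis unfolding eq using subspace_0[OF subT[of "Suc i"]] by simp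
      next
        case False
        then have "T j \<subseteq> (\<Sum>j\<in>{Suc i..d}. T j)"
          using j' by (intro set_sum_superset sT) auto
        then show ?thesis unfolding eq using v subT[of "Suc i"] by (auto intro: subspace_scale)
      qed
    qed
    show "As v \<in> (\<Sum>j\<in>{i..d}. T j)" if v: "v \<in> (\<Sum>j\<in>{Suc i..d}. T j)" for i v
    proof (rule linear_set_sum_mem[OF linAs subT v])
      fix j v assume j: "j \<in> {Suc i..d}" and v: "v \<in> T j"
      have "As ` T j \<subseteq> (\<Sum>j\<in>{i..d}. T j)"
        by (rule order.trans[OF tri set_sum_mono]) (use j sT in auto)
      with v show "As v \<in> (\<Sum>j\<in>{i..d}. T j)" by blast
    qed
    show "(\<Sum>j\<in>{Suc d..d}. T j) = {0}" by (simp add: set_zero)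
    show "(\<Sum>j\<in>{0..d}. T j) = UNIV" "(\<Sum>j\<in>{1..d}. T j) \<noteq> UNIV" by fact+
    show "(\<Sum>j\<in>{0..0}. S j) \<noteq> {0}" using S_0 by simp
  qed
qed

text \<open>\<open>E k\<close> kills every summand, so if they filled the space it would be zero,
  although its range is an eigenspace and hence nonzero. Applied with \<open>k = 0\<close> to see
  that \<open>G 1\<close> is proper.\<close>

lemma sum_idempotent_ranges_neq_UNIV:
  assumes "\<And>j. j \<in> J \<Longrightarrow> range (E j) \<in> eigenspaces scale A - {range (E k)}"
    and "primitive_idempotent scale A (range (E k)) (E k)"
  shows "(\<Sum>j\<in>J. range (E j)) \<noteq> UNIV"
proof
  assume U: "(\<Sum>j\<in>J. range (E j)) = UNIV"
  have lin: "Vector_Spaces.linear scale scale (E k)"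
    and zero: "\<And>W v. \<lbrakk>W \<in> eigenspaces scale A - {range (E k)}; v \<in> W\<rbrakk> \<Longrightarrow> E k v = 0"
    and eig: "range (E k) \<in> eigenspaces scale A"
    using assms(2) unfolding primitive_idempotent_def by blast+
  have "E k v \<in> {0}" for v
  proof (rule linear_set_sum_mem[OF lin])
    show "v \<in> (\<Sum>j\<in>J. range (E j))" by (simp add: U)
    fix j w assume "j \<in> J" "w \<in> range (E j)"
    then show "E k w \<in> {0}" using zero[OF assms(1)] by blast
  qed simp
  then have "range (E k) = {0}" by auto
  with eig show False by (auto simp: eigenspaces_def)
qed

lemma set_sum_standard_ordering:
  assumes "standard_ordering scale A B d W" "diagonalizable scale A" "Vector_Spaces.linear scale scale A"
  shows "(\<Sum>j\<in>{..d}. W j) = UNIV"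
proof -
  have bij: "W ` {..d} = eigenspaces scale A"
    using assms(1) by (auto simp: standard_ordering_def bij_betw_def)
  have sub: "subspace (W j)" if "j \<in> {..d}" for j
  proof -
    have "W j \<in> eigenspaces scale A" using bij that by blast
    then show ?thesis using eigenspace_subspace[OF assms(3)] by (auto simp: eigenspaces_def)
  qed
  have "W i \<subseteq> (\<Sum>j\<in>{..d}. W j)" if "i \<in> {..d}" for i
    using finite_atMost sub that by (rule set_sum_superset)
  then have "\<Union> (eigenspaces scale A) \<subseteq> (\<Sum>j\<in>{..d}. W j)"
    unfolding bij[symmetric] by blast
  then have "span (\<Union> (eigenspaces scale A)) \<subseteq> (\<Sum>j\<in>{..d}. W j)"
    by (rule span_minimal) (rule subspace_set_sum[OF sub])
  then show ?thesis using assms(2) by (auto simp: diagonalizable_def)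
qed

end

section \<open>Reversing the order of the eigenspaces\<close>

text \<open>The index set encodes that \<open>i\<close> and \<open>j\<close> differ by at most one,
  a relation preserved by \<open>j \<mapsto> d - j\<close>.\<close>

lemma standard_ordering_reverse:
  assumes "standard_ordering scale A B d W"
  shows "standard_ordering scale A B d (\<lambda>i. W (d - i))"
  unfolding standard_ordering_def
proof
  have rev: "bij_betw (\<lambda>i. d - i) {..d} {..d}"
    by (rule bij_betw_byWitness[where f' = "\<lambda>i. d - i"]) auto
  show "bij_betw (\<lambda>i. W (d - i)) {..d} (eigenspaces scale A)"
    using bij_betw_trans[OF rev] assms by (auto simp: standard_ordering_def o_def)
  show "\<forall>i\<le>d. B ` W (d - i) \<subseteq> (\<Sum>j\<in>{j. j \<le> d \<and> i \<le> j + 1 \<and> j \<le> i + 1}. W (d - j))"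
  proof (intro allI impI)
    fix i assume i: "i \<le> d"
    have "(\<Sum>j\<in>{j. j \<le> d \<and> i \<le> j + 1 \<and> j \<le> i + 1}. W (d - j)) =
        (\<Sum>j\<in>{j. j \<le> d \<and> d - i \<le> j + 1 \<and> j \<le> d - i + 1}. W j)"
      by (rule sum.reindex_bij_witness[where i = "\<lambda>j. d - j" and j = "\<lambda>j. d - j"]) (use i in auto)
    then show "B ` W (d - i) \<subseteq> (\<Sum>j\<in>{j. j \<le> d \<and> i \<le> j + 1 \<and> j \<le> i + 1}. W (d - j))"
      using assms i by (auto simp: standard_ordering_def)
  qed
qed

text \<open>Only the order of the \<open>E i\<close> changes; the \<open>Es i\<close> keep theirs,
  so the flag \<open>F\<close> is common to both systems.\<close>

lemma TD_system_reverse: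
  assumes "TD_system scale d A E As Es"
  shows "TD_system scale d A (\<lambda>i. E (d - i)) As Es"
proof -
  have "standard_ordering scale A As d (\<lambda>i. range (E i))"
    using assms unfolding TD_system_def by blast
  note standard_ordering_reverse[OF this]
  moreover have "primitive_idempotent scale A (range (E (d - i))) (E (d - i))" for i
    using assms unfolding TD_system_def by (meson diff_le_self)
  ultimately show ?thesis
    using assms unfolding TD_system_def by (intro conjI allI impI) blast+
qed

text \<open>Reindexing by \<open>j \<mapsto> d - j\<close> exhibits the second split decomposition
  as the first one of the reversed system.\<close>

lemma split_space_down_eq_reverse:
  assumes "i \<le> d"
  shows "split_space_down d E Es i = split_space d (\<lambda>i. E (d - i)) Es i"
proof -
  have "(\<Sum>j\<in>{i..d}. range (E (d - j))) = (\<Sum>j\<in>{0..d - i}. range (E j))"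
    by (rule sum.reindex_bij_witness[where i = "\<lambda>j. d - j" and j = "\<lambda>j. d - j"]) (use assms in auto)
  then show ?thesis by (simp add: split_space_def split_space_down_def)
qed

section \<open>The flags of a TD system, and the denominator in the definition of M\<close>

context vector_space
begin

text \<open>Irreducibility is condition (iv) of a TD pair, \<open>G 0 = UNIV\<close> comes from
  diagonalizability of \<open>A\<close>, and \<open>G 1\<close> is proper because the eigenspace of
  \<open>E 0\<close> is missing from it.\<close>

lemma TD_system_split_flags:
  assumes "TD_system scale d A E As Es"
  shows "split_flags scale d A As (\<lambda>i. \<Sum>j\<in>{0..i}. range (Es j)) (\<lambda>i. \<Sum>j\<in>{i..d}. range (E j))
    (\<lambda>i. eigenvalue_on scale A (range (E i))) (\<lambda>i. eigenvalue_on scale As (range (Es i)))"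
proof (rule split_flags_eigenspaces)
  have td: "TD_pair scale A As"
    and std: "standard_ordering scale A As d (\<lambda>i. range (E i))"
    and stds: "standard_ordering scale As A d (\<lambda>i. range (Es i))"
    and idem: "\<And>i. i \<le> d \<Longrightarrow> primitive_idempotent scale A (range (E i)) (E i)"
    and idems: "\<And>i. i \<le> d \<Longrightarrow> primitive_idempotent scale As (range (Es i)) (Es i)"
    using assms by (auto simp: TD_system_def)
  show linA: "Vector_Spaces.linear scale scale A" and linAs: "Vector_Spaces.linear scale scale As"
    using td by (auto simp: TD_pair_def)
  show "W = {0} \<or> W = UNIV" if "subspace W" "A ` W \<subseteq> W" "As ` W \<subseteq> W" for W
    using td that unfolding TD_pair_def by blast
  show "range (E i) = eigenspace scale A (eigenvalue_on scale A (range (E i)))" if "i \<le> d" for i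
    using idem[OF that] linA by (intro eigenspaces_eq_eigenspace) (auto simp: primitive_idempotent_def)
  show "range (Es i) = eigenspace scale As (eigenvalue_on scale As (range (Es i)))" if "i \<le> d" for i
    using idems[OF that] linAs by (intro eigenspaces_eq_eigenspace) (auto simp: primitive_idempotent_def)
  show "As ` range (E i) \<subseteq> (\<Sum>j\<in>{j. j \<le> d \<and> i \<le> j + 1 \<and> j \<le> i + 1}. range (E j))" if "i \<le> d" for i
    using std that unfolding standard_ordering_def by blast
  show "A ` range (Es i) \<subseteq> (\<Sum>j\<in>{j. j \<le> d \<and> i \<le> j + 1 \<and> j \<le> i + 1}. range (Es j))" if "i \<le> d" for i
    using stds that unfolding standard_ordering_def by blast
  show "(\<Sum>j\<in>{0..d}. range (E j)) = UNIV"
    using set_sum_standard_ordering[OF std _ linA] td by (simp add: TD_pair_def atLeast0AtMost)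
  show "(\<Sum>j\<in>{1..d}. range (E j)) \<noteq> UNIV"
  proof (rule sum_idempotent_ranges_neq_UNIV)
    show "primitive_idempotent scale A (range (E 0)) (E 0)" by (simp add: idem)
    fix j assume j: "j \<in> {1..d}"
    have bij: "bij_betw (\<lambda>i. range (E i)) {..d} (eigenspaces scale A)"
      using std by (simp add: standard_ordering_def)
    have "range (E j) \<noteq> range (E 0)"
      using inj_onD[OF bij_betw_imp_inj_on[OF bij], of j 0] j by auto
    with bij_betwE[OF bij] j show "range (E j) \<in> eigenspaces scale A - {range (E 0)}" by auto
  qed
  show "range (Es 0) \<noteq> {0}"
    using idems[OF le0] by (auto simp only: primitive_idempotent_def eigenspaces_def mem_Collect_eq)
qed

text \<open>If \<open>a\<close> were its own inverse, the eigenvalues at indices \<open>0\<close>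
  and \<open>d\<close> would coincide, and so would their eigenspaces, against
  \<open>d \<ge> 1\<close>. Without this the convention \<open>inverse 0 = 0\<close> would turn
  \<open>M_map\<close> into the zero map.\<close>

lemma q_Racah_neq_inverse:
  assumes "TD_system scale d A E As Es" "q_Racah scale d A E As Es q a b" "d \<ge> 1"
  shows "a - inverse a \<noteq> 0"
proof
  assume "a - inverse a = 0"
  then have inv: "inverse a = a" by (rule right_minus_eq[THEN iffD1, symmetric])
  have th: "eigenvalue_on scale A (range (E i)) =
      a * q powi (int d - 2 * int i) + inverse a * q powi (2 * int i - int d)" if "i \<le> d" for i
    using assms(2) that unfolding q_Racah_def by blast
  \<comment> \<open>Passing from index \<open>0\<close> to \<open>d\<close> interchanges the two
    exponents, so with equal coefficients the two terms merely swap.\<close>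
  have diff: "int d - 2 * int d = 2 * int 0 - int d" "2 * int d - int d = int d - 2 * int 0" by auto
  have "eigenvalue_on scale A (range (E 0)) = eigenvalue_on scale A (range (E d))"
    unfolding th[OF le0] th[OF le_refl] inv diff by (rule add.commute)
  moreover have "range (E i) = eigenspace scale A (eigenvalue_on scale A (range (E i)))" if "i \<le> d" for i
  proof (rule eigenspaces_eq_eigenspace)
    show "range (E i) \<in> eigenspaces scale A"
      using assms(1) that unfolding TD_system_def primitive_idempotent_def by blast
    show "Vector_Spaces.linear scale scale A"
      using assms(1) unfolding TD_system_def TD_pair_def by blast
  qed
  ultimately have "range (E 0) = range (E d)" by (metis le_refl zero_le)
  moreover have "inj_on (\<lambda>i. range (E i)) {..d}"
    using assms(1) by (auto simp: TD_system_def standard_ordering_def bij_betw_def)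
  ultimately show False using assms(3) by (auto dest: inj_onD[where x = 0 and y = d])
qed

end

section \<open>Comparison of the two split decompositions\<close>

text \<open>Used because \<open>split_space_down\<close> is identified with the reversed split
  decomposition only for indices up to \<open>d\<close>.\<close>

lemma weight_map_cong:
  assumes "\<And>i. i \<le> d \<Longrightarrow> U i = U' i"
  shows "weight_map scale d q U = weight_map scale d q U'"
  using assms by (simp add: weight_map_def)

theorem lemma10p1:
  fixes scale :: "'k::alg_closed_field \<Rightarrow> 'v::ab_group_add \<Rightarrow> 'v"
    and Basis :: "'v set"
    and A As :: "'v \<Rightarrow> 'v"
    and E Es :: "nat \<Rightarrow> 'v \<Rightarrow> 'v"
    and q a b :: 'k
    and d i :: nat
  assumes "finite_dimensional_vector_space scale Basis"
    and "vector_space.dim scale (UNIV :: 'v set) > 0"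
    and "d \<ge> 1"
    and "TD_system scale d A E As Es"
    and "q_Racah scale d A E As Es q a b"
    and "i \<le> d"
  shows "(\<lambda>v. M_map scale d E Es q a v - scale (q powi (int d - 2 * int i)) v)
             ` split_space d E Es i
           \<subseteq> (\<Sum>j\<in>{..<i}. split_space d E Es j) \<and>
         (\<lambda>v. M_map scale d E Es q a v - scale (q powi (int d - 2 * int i)) v)
             ` split_space_down d E Es i
           \<subseteq> (\<Sum>j\<in>{..<i}. split_space_down d E Es j)"
proof -
  interpret finite_dimensional_vector_space scale Basis by fact
  define E' where "E' i = E (d - i)" for i
  interpret K: split_flags scale d A As "\<lambda>i. \<Sum>j\<in>{0..i}. range (Es j)" "\<lambda>i. \<Sum>j\<in>{i..d}. range (E j)"
      "\<lambda>i. eigenvalue_on scale A (range (E i))" "\<lambda>i. eigenvalue_on scale As (range (Es i))"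
    by (rule TD_system_split_flags[OF assms(4)])
  interpret B: split_flags scale d A As "\<lambda>i. \<Sum>j\<in>{0..i}. range (Es j)" "\<lambda>i. \<Sum>j\<in>{i..d}. range (E' j)"
      "\<lambda>i. eigenvalue_on scale A (range (E' i))" "\<lambda>i. eigenvalue_on scale As (range (Es i))"
    by (rule TD_system_split_flags) (use TD_system_reverse[OF assms(4)] in \<open>simp add: E'_def[abs_def]\<close>)
  have KU: "K.U = split_space d E Es" by (rule ext) (simp add: K.U_def split_space_def)
  have "B.U = split_space d E' Es" by (rule ext) (simp add: B.U_def split_space_def)
  then have BU: "split_space_down d E Es j = B.U j" if "j \<le> d" for j
    using split_space_down_eq_reverse[OF that, of E Es] by (simp add: E'_def[abs_def])
  define P where "P = (\<Sum>j\<in>{..<i}. split_space d E Es j)"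
  \<comment> \<open>For \<open>i = Suc k\<close> both sums equal the common \<open>F k\<close>; for
    \<open>i = 0\<close> both are empty. The two inclusions thus share the target
    \<open>P\<close>.\<close>
  have PB: "(\<Sum>j\<in>{..<i}. B.U j) = P"
  proof (cases i)
    case (Suc k)
    then show ?thesis
      using K.F_eq_sum_U[of k] B.F_eq_sum_U[of k] \<open>i \<le> d\<close> by (simp add: P_def KU lessThan_Suc_atMost)
  qed (simp add: P_def)
  have PD: "(\<Sum>j\<in>{..<i}. split_space_down d E Es j) = P"
    using PB BU \<open>i \<le> d\<close> by simp
  have "subspace P"
    unfolding P_def KU[symmetric] using \<open>i \<le> d\<close> by (intro subspace_set_sum K.subspace_U) auto
  define c where "c = q powi (int d - 2 * int i)"
  \<comment> \<open>The \<open>i\<close>-th summand of either decomposition lies in this member of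
    the flag, so one statement serves both inclusions.\<close>
  have main: "M_map scale d E Es q a v - scale c v \<in> P" if v: "v \<in> (\<Sum>j\<in>{0..i}. range (Es j))" for v
  proof -
    define k where "k = K_map scale d E Es q v"
    define l where "l = B_map scale d E Es q v"
    have k: "k - scale c v \<in> P"
      using K.weight_map_on_F[OF \<open>i \<le> d\<close> v, of q] by (simp add: k_def K_map_def KU P_def c_def)
    have l: "l - scale c v \<in> P"
      using B.weight_map_on_F[OF \<open>i \<le> d\<close> v, of q] weight_map_cong[OF BU, where scale = scale and q = q]
      by (simp add: l_def B_map_def PB c_def)
    define r where "r = inverse (a - inverse a)"
    \<comment> \<open>The coefficients of \<open>K_map\<close> and \<open>B_map\<close> in
      \<open>M_map\<close> add up to one, so \<open>c\<close> can be distributed over the two terms;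
      here \<open>a - inverse a\<close> must be nonzero.\<close>
    have "c = r * a * c - r * inverse a * c"
      using q_Racah_neq_inverse[OF assms(4,5,3)]
      by (simp add: r_def left_diff_distrib[symmetric] right_diff_distrib[symmetric])
    then have "scale c v = scale (r * a * c) v - scale (r * inverse a * c) v"
      by (metis scale_left_diff_distrib)
    moreover have "scale r (scale a (k - scale c v) - scale (inverse a) (l - scale c v)) =
        scale r (scale a k - scale (inverse a) l) - (scale (r * a * c) v - scale (r * inverse a * c) v)"
      by (simp add: scale_right_diff_distrib mult.assoc)
    ultimately have "M_map scale d E Es q a v - scale c v =
        scale r (scale a (k - scale c v) - scale (inverse a) (l - scale c v))"
      by (simp only: M_map_def k_def l_def r_def)
    also have "\<dots> \<in> P"
      by (intro subspace_scale subspace_diff[OF \<open>subspace P\<close>] \<open>subspace P\<close> k l)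
    finally show ?thesis .
  qed
  show ?thesis
    unfolding PD P_def[symmetric] c_def[symmetric]
    using main by (simp add: image_subset_iff split_space_def split_space_down_def)
qed

end
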